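(* Let $N$ be a non-negative integer, $\nu\in\{0,1\}$, let $a,b,c,d$ be variables and $Q=abcd$. Then \begin{align*} \Phi_{2N+\nu}(a,b,c,d) &=\frac{1}{(Q;Q)_{N}}\sum_{i=0}^N \genfrac{[}{]}{0pt}{}{N}{i}_{Q} \frac{(-a;Q)_{i+\nu}(-abc;Q)_{i} }{(ac;Q)_{i+\nu}}(ab)^{N-i},\\ \Psi_{2N+\nu}(a,b,c,d) &=\sum_{i=0}^N \genfrac{[}{]}{0pt}{}{N}{i}_{Q} (-a;Q)_{i+\nu}(-abc;Q)_{i}\, \frac{(ac;Q)_{N+\nu}}{(ac;Q)_{i+\nu}}(ab)^{N-i}. \end{align*}
   Context: A partition $\pi=(\lambda_1,\lambda_2,\dots)$ is a finite non-increasing sequence of positive integers (its parts); the empty sequence is the unique partition of $0$. Decorate the Ferrers diagram of $\pi$ (row $r$ has $\lambda_r$ boxes) as follows: boxes in the odd-indexed rows $\lambda_1,\lambda_3,\dots$ are filled alternately with $a,b,a,b,\dots$ starting from $a$, and boxes in the even-indexed rows $\lambda_2,\lambda_4,\dots$ are filled alternately with $c,d,c,d,\dots$ starting from $c$. The weight is $\omega_\pi(a,b,c,d)=a^{\#a}b^{\#b}c^{\#c}d^{\#d}$, where $\#a$ is the number of boxes filled with $a$, etc. Let $U_N$ be the set of all partitions with parts $\le N$ and $D_N$ the set of partitions into distinct parts $\le N$. Define $\Phi_N(a,b,c,d)=\sum_{\pi\in U_N}\omega_\pi(a,b,c,d)$ and $\Psi_N(a,b,c,d)=\sum_{\pi\in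 D_N}\omega_\pi(a,b,c,d)$ (as formal power series). Notation: $(x;q)_L=\prod_{n=0}^{L-1}(1-xq^n)$; $\genfrac{[}{]}{0pt}{}{m}{n}_q=\frac{(q;q)_m}{(q;q)_n(q;q)_{m-n}}$ for $m\ge n\ge0$ and $0$ otherwise. *)

theory Defs
  imports "HOL-Analysis.Infinite_Sum"
begin

section \<open>Partitions and the four-variable weight\<close>

definition is_partition :: "nat list \<Rightarrow> bool" where
  "is_partition p \<longleftrightarrow> sorted_wrt (\<ge>) p \<and> (\<forall>x\<in>set p. x > 0)"

definition U :: "nat \<Rightarrow> nat list set" where
  "U N = {p. is_partition p \<and> (\<forall>x\<in>set p. x \<le> N)}"

definition D :: "nat \<Rightarrow> nat list set" where
  "D N = {p. is_partition p \<and> distinct p \<and> (\<forall>x\<in>set p. x \<le> N)}"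

text \<open>
  Rows and columns are numbered from 0 here. So the rows with an even index are
  \<open>\<lambda>\<^sub>1, \<lambda>\<^sub>3, \<dots>\<close>, and the first box of each row has column index 0.
\<close>

definition boxes :: "nat list \<Rightarrow> (nat \<times> nat) set" where
  "boxes p = {(r, s). r < length p \<and> s < p ! r}"

datatype letter = LA | LB | LC | LD

fun filling :: "nat \<times> nat \<Rightarrow> letter" where
  "filling (r, s) =
     (if even r then (if even s then LA else LB) else (if even s then LC else LD))"

definition num_letter :: "letter \<Rightarrow> nat list \<Rightarrow> nat" where
  "num_letter x p = card {z \<in> boxes p. filling z = x}"

definition weight :: "nat list \<Rightarrow> 'r \<Rightarrow> 'r \<Rightarrow> 'r \<Rightarrow> 'r \<Rightarrow> 'r::comm_monoid_mult" where
  "weight p a b c d =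
     a ^ num_letter LA p * b ^ num_letter LB p * c ^ num_letter LC p * d ^ num_letter LD p"

definition Phi :: "nat \<Rightarrow> 'r \<Rightarrow> 'r \<Rightarrow> 'r \<Rightarrow> 'r \<Rightarrow> 'r::{comm_ring_1, t2_space}" where
  "Phi N a b c d = (\<Sum>\<^sub>\<infinity>p\<in>U N. weight p a b c d)"

text \<open>There are only finitely many partitions into distinct parts \<open>\<le> N\<close> (\<open>finite_D\<close> below).\<close>

definition Psi :: "nat \<Rightarrow> 'r \<Rightarrow> 'r \<Rightarrow> 'r \<Rightarrow> 'r \<Rightarrow> 'r::comm_ring_1" where
  "Psi N a b c d = (\<Sum>p\<in>D N. weight p a b c d)"


section \<open>\<open>q\<close>-notation\<close>

definition qpoch :: "'r \<Rightarrow> 'r \<Rightarrow> nat \<Rightarrow> 'r::comm_ring_1" where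
  "qpoch x q L = (\<Prod>n<L. 1 - x * q ^ n)"

definition qbinom :: "nat \<Rightarrow> nat \<Rightarrow> 'r \<Rightarrow> 'r::{comm_ring_1, inverse}" where
  "qbinom m n q = (if n \<le> m then qpoch q q m / (qpoch q q n * qpoch q q (m - n)) else 0)"


section \<open>Formal power series in four variables\<close>

text \<open>
  The ring of formal power series in \<open>a, b, c, d\<close> over \<open>'k\<close> is the iterated ring
  \<open>'k[[d]][[c]][[b]][[a]]\<close>, with \<open>a\<close> the outermost variable. Every denominator used here has
  constant coefficient 1, so division is multiplication by the inverse power series.
\<close>

type_synonym 'k fps4 = "'k fps fps fps fps"

definition var_a :: "'k::field fps4" where "var_a = fps_X"
definition var_b :: "'k::field fps4" where "var_b = fps_const fps_X"
definition var_c :: "'k::field fps4" where "var_c = fps_const (fps_const fps_X)"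
definition var_d :: "'k::field fps4" where "var_d = fps_const (fps_const (fps_const fps_X))"

text \<open>
  The topology on the iterated ring is the one of the outermost variable \<open>a\<close>, with the inner ring
  discrete. It is finer than coefficientwise convergence, but the sum defining \<open>Phi\<close> still
  converges: a partition with \<open>n\<close> boxes filled with \<open>a\<close> has at most \<open>2 * n\<close> rows. The rest of this
  theory proves this, that the limit is the generating function of \<open>U N\<close>, and
  that the divisions are exact.
\<close>

unbundle fps_syntax

lemma finite_boxes: "finite (boxes p)"
proof -
  have "boxes p \<subseteq> (SIGMA r:{..<length p}. {..<p ! r})"
    by (auto simp: boxes_def)
  then show ?thesis by (rule finite_subset) auto
qed

lemma length_le_num_LA:
  assumes "is_partition p"
  shows "length p \<le> 2 * num_letter LA p"
proof -
  let ?f = "\<lambda>r. (2 * r, 0 :: nat)"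
  have "?f ` {..<(length p + 1) div 2} \<subseteq> {z \<in> boxes p. filling z = LA}"
    using assms by (auto simp: boxes_def is_partition_def)
  then have "card (?f ` {..<(length p + 1) div 2}) \<le> num_letter LA p"
    unfolding num_letter_def by (intro card_mono) (auto simp: finite_boxes)
  moreover have "card (?f ` {..<(length p + 1) div 2}) = (length p + 1) div 2"
    by (subst card_image) (auto simp: inj_on_def)
  ultimately show ?thesis by linarith
qed

lemma finite_U_num_LA: "finite {p \<in> U N. num_letter LA p \<le> n}"
proof (rule finite_subset)
  show "{p \<in> U N. num_letter LA p \<le> n} \<subseteq> {p. set p \<subseteq> {..N} \<and> length p \<le> 2 * n}"
    using length_le_num_LA by (force simp: U_def)
  show "finite {p. set p \<subseteq> {..N} \<and> length p \<le> 2 * n}"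
    by (rule finite_lists_length_le) simp
qed

lemma finite_D: "finite (D N)"
proof (rule finite_subset)
  show "D N \<subseteq> {p. set p \<subseteq> {..N} \<and> distinct p}"
    by (auto simp: D_def)
  show "finite {p. set p \<subseteq> {..N} \<and> distinct p}"
    by (rule finite_subset_distinct) simp
qed

lemma weight_vars:
  "weight p var_a var_b var_c (var_d :: 'k::field fps4) =
     fps_X ^ num_letter LA p * fps_const (fps_X ^ num_letter LB p *
       fps_const (fps_X ^ num_letter LC p * fps_const (fps_X ^ num_letter LD p)))"
  by (simp add: weight_def var_a_def var_b_def var_c_def var_d_def mult.assoc)

lemma weight_vars_nth:
  "weight p var_a var_b var_c (var_d :: 'k::field fps4) $ i $ j $ k $ l =
     (if num_letter LA p = i \<and> num_letter LB p = j \<and> num_letter LC p = k \<and> num_letter LD p = l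
      then 1 else 0)"
  by (auto simp: weight_vars fps_X_power_nth)

lemma has_sum_fps:
  fixes F :: "'p \<Rightarrow> 'r::comm_ring_1 fps"
  assumes fin: "\<And>n. finite {p \<in> A. \<exists>m\<le>n. F p $ m \<noteq> 0}"
  shows "(F has_sum Abs_fps (\<lambda>n. \<Sum>p | p \<in> A \<and> F p $ n \<noteq> 0. F p $ n)) A"
proof -
  let ?S = "Abs_fps (\<lambda>n. \<Sum>p | p \<in> A \<and> F p $ n \<noteq> 0. F p $ n)"
  have nth: "sum F X $ m = ?S $ m"
    if X: "finite X" "{p \<in> A. \<exists>m\<le>n. F p $ m \<noteq> 0} \<subseteq> X" "X \<subseteq> A" and m: "m \<le> n" for X n m
  proof -
    have "(\<Sum>p\<in>X. F p $ m) = (\<Sum>p | p \<in> A \<and> F p $ m \<noteq> 0. F p $ m)"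
      by (rule sum.mono_neutral_right) (use X m in auto)
    then show ?thesis by (simp add: fps_sum_nth)
  qed
  have "(sum F \<longlongrightarrow> ?S) (finite_subsets_at_top A)"
    unfolding tendsto_iff
  proof (intro allI impI)
    fix e :: real assume "e > 0"
    then obtain n where n: "inverse (2 ^ n) < e"
        using real_arch_pow_inv[of e "1/2"] by (auto simp: power_one_over inverse_eq_divide)
    have "dist (sum F X) ?S < e"
      if "finite X" "{p \<in> A. \<exists>m\<le>n. F p $ m \<noteq> 0} \<subseteq> X" "X \<subseteq> A" for X
    proof (cases "sum F X = ?S")
      case True
      then show ?thesis using \<open>e > 0\<close> by simp
    next
      case False
      have "subdegree (sum F X - ?S) \<ge> n"
        by (rule subdegree_geI) (use False nth[OF that] in auto)
      then have "inverse (2 ^ subdegree (sum F X - ?S)) \<le> inverse (2 ^ n :: real)"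
        by (intro le_imp_inverse_le power_increasing) auto
      then have "inverse (2 ^ subdegree (sum F X - ?S)) < e"
        using n by (rule le_less_trans)
      then show ?thesis using False by (simp add: dist_fps_def)
    qed
    then show "\<forall>\<^sub>F X in finite_subsets_at_top A. dist (sum F X) ?S < e"
      unfolding eventually_finite_subsets_at_top
      using fin[of n] by (intro exI[of _ "{p \<in> A. \<exists>m\<le>n. F p $ m \<noteq> 0}"]) auto
  qed
  then show ?thesis by (simp add: has_sum_def)
qed

lemma weight_vars_nth_eq_0:
  "weight p var_a var_b var_c (var_d :: 'k::field fps4) $ i = 0 \<longleftrightarrow> num_letter LA p \<noteq> i"
proof
  assume "weight p var_a var_b var_c (var_d :: 'k fps4) $ i = 0"
  then show "num_letter LA p \<noteq> i"
    using weight_vars_nth[of p i "num_letter LB p" "num_letter LC p" "num_letter LD p",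
        where 'k = 'k] by auto
next
  assume "num_letter LA p \<noteq> i"
  then show "weight p var_a var_b var_c (var_d :: 'k fps4) $ i = 0"
    by (simp add: weight_vars fps_X_power_nth)
qed

lemma weight_has_sum:
  "((\<lambda>p. weight p var_a var_b var_c (var_d :: 'k::field fps4)) has_sum
     Phi N var_a var_b var_c var_d) (U N)"
proof -
  have "(\<lambda>p. weight p var_a var_b var_c (var_d :: 'k fps4)) summable_on U N"
    using has_sum_fps[of "U N" "\<lambda>p. weight p var_a var_b var_c (var_d :: 'k fps4)"]
      finite_U_num_LA[of N]
    unfolding summable_on_def by (auto simp: weight_vars_nth_eq_0)
  then show ?thesis unfolding Phi_def by (rule has_sum_infsum)
qed

lemma Phi_nth:
  "Phi N var_a var_b var_c (var_d :: 'k::field fps4) $ i $ j $ k $ l =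
     of_nat (card {p \<in> U N. num_letter LA p = i \<and> num_letter LB p = j \<and>
                            num_letter LC p = k \<and> num_letter LD p = l})"
proof -
  let ?w = "\<lambda>p. weight p var_a var_b var_c (var_d :: 'k fps4)"
  let ?P = "{p \<in> U N. num_letter LA p = i}"
  have "(?w has_sum Abs_fps (\<lambda>n. \<Sum>p | p \<in> U N \<and> ?w p $ n \<noteq> 0. ?w p $ n)) (U N)"
    using finite_U_num_LA[of N] by (intro has_sum_fps) (simp add: weight_vars_nth_eq_0)
  then have "Phi N var_a var_b var_c (var_d :: 'k fps4) $ i = (\<Sum>p\<in>?P. ?w p $ i)"
    by (simp add: Phi_def infsumI weight_vars_nth_eq_0)
  then have "Phi N var_a var_b var_c (var_d :: 'k fps4) $ i $ j $ k $ l =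
      (\<Sum>p\<in>?P. ?w p $ i $ j $ k $ l)"
    by (simp add: fps_sum_nth)
  also have "\<dots> = (\<Sum>p\<in>?P. if num_letter LB p = j \<and> num_letter LC p = k \<and> num_letter LD p = l
                    then 1 else 0)"
    by (intro sum.cong) (auto simp: weight_vars_nth)
  also have "\<dots> = of_nat (card {p \<in> ?P. num_letter LB p = j \<and> num_letter LC p = k \<and>
                                        num_letter LD p = l})"
    using finite_subset[OF _ finite_U_num_LA[of N i], of ?P]
    by (subst sum.inter_filter[symmetric]) auto
  finally show ?thesis by (simp add: conj_assoc)
qed

lemma qpoch_nth_0:
  fixes x q :: "'r::comm_ring_1 fps"
  assumes "x $ 0 = 0"
  shows "qpoch x q L $ 0 = 1"
  using assms by (induction L) (simp_all add: qpoch_def)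

text \<open>Division by such a series is exact, for the nested coefficient rings as well.\<close>

lemma fps4_divide_mult:
  fixes f g :: "'k::field fps4"
  assumes "g $ 0 = 1"
  shows "f / g * g = f"
proof -
  have "inverse (1 :: 'k fps fps) = 1"
    by (rule fps_inverse_one') simp
  then have "inverse (1 :: 'k fps fps fps) = 1"
    by (rule fps_inverse_one')
  then have "g * inverse g = 1"
    using assms fps_right_inverse[of g 1] by (simp add: fps_inverse_def)
  moreover have "f / g = f * inverse g"
    using assms by (intro fps_divide_unit) simp
  ultimately show ?thesis by (simp add: mult_ac)
qed

unbundle no fps_syntax

end

theory Submission
  imports Defs
begin

text \<open>
  Deleting the first row exchanges the odd and the even rows. Hence, with \<open>w\<close> the weight of a row
  of length \<open>n + 1\<close> in first position and \<open>w'\<close> its weight in second position,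
  \<open>\<Psi>\<^bsub>n+1\<^esub>(a,b,c,d) = \<Psi>\<^sub>n(a,b,c,d) + w \<Psi>\<^sub>n(c,d,a,b)\<close> and
  \<open>\<Phi>\<^bsub>n+1\<^esub>(a,b,c,d) = \<Phi>\<^sub>n(a,b,c,d) + w \<Phi>\<^bsub>n+1\<^esub>(c,d,a,b)\<close>.
  Solving the second system for \<open>\<Phi>\<^bsub>n+1\<^esub>\<close> shows that \<open>\<Phi>\<^sub>n\<close> times the product of the factors
  \<open>1 - w w'\<close> over the row lengths \<open>1, \<dots>, n\<close> satisfies the recurrence of \<open>\<Psi>\<^sub>n\<close>, so the two identities
  are equivalent. Eliminating \<open>\<Psi>\<^sub>n(c,d,a,b)\<close> from the first system gives recurrences of order two
  for \<open>\<Psi>\<^sub>n(a,b,c,d)\<close> alone. The right-hand side satisfies them too: for even \<open>n\<close> this holds term by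
  term after applying Pascal's rule, and for odd \<open>n\<close> the difference of the two sides telescopes.
\<close>

unbundle fps_syntax

subsection \<open>The topology of formal power series\<close>

text \<open>The rules for \<open>has_sum\<close> on disjoint unions and scalar multiples need
  continuous addition and multiplication. Convergence of power series means that each coefficient
  eventually equals that of the limit, and coefficient n of a sum or product depends only on
  coefficients up to n.\<close>

instance fps :: (comm_ring_1) topological_comm_monoid_add
proof
  fix f g :: "'a fps"
  show "LIM x nhds f \<times>\<^sub>F nhds g. fst x + snd x :> nhds (f + g)"
  proof (rule tendsto_fpsI)
    fix n
    have "\<forall>\<^sub>F x in nhds f \<times>\<^sub>F nhds g. fst x $ n = f $ n"
      and "\<forall>\<^sub>F x in nhds f \<times>\<^sub>F nhds g. snd x $ n = g $ n"
      using filterlim_fst[of "nhds f" "nhds g"] filterlim_snd[of "nhds g" "nhds f"]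
      unfolding tendsto_fps_iff by blast+
    then show "\<forall>\<^sub>F x in nhds f \<times>\<^sub>F nhds g. (fst x + snd x) $ n = (f + g) $ n"
      by eventually_elim simp
  qed
qed

instance fps :: (comm_ring_1) topological_semigroup_mult
proof
  fix f g :: "'a fps"
  show "LIM x nhds f \<times>\<^sub>F nhds g. fst x * snd x :> nhds (f * g)"
  proof (rule tendsto_fpsI)
    fix n
    have "\<forall>\<^sub>F x in nhds f \<times>\<^sub>F nhds g. \<forall>m\<in>{..n}. fst x $ m = f $ m"
      and "\<forall>\<^sub>F x in nhds f \<times>\<^sub>F nhds g. \<forall>m\<in>{..n}. snd x $ m = g $ m"
      using filterlim_fst[of "nhds f" "nhds g"] filterlim_snd[of "nhds g" "nhds f"]
      unfolding tendsto_fps_iff by (auto intro!: eventually_ball_finite)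
    then show "\<forall>\<^sub>F x in nhds f \<times>\<^sub>F nhds g. (fst x * snd x) $ n = (f * g) $ n"
      by eventually_elim (simp add: fps_mult_nth)
  qed
qed

subsection \<open>Deleting the first row\<close>

definition row_weight :: "nat \<Rightarrow> 'r \<Rightarrow> 'r \<Rightarrow> 'r::comm_monoid_mult" where
  "row_weight m a b = a ^ ((m + 1) div 2) * b ^ (m div 2)"

lemma row_weight_even: "row_weight (2 * n) a b = (a * b) ^ n"
  by (simp add: row_weight_def power_mult_distrib)

lemma row_weight_odd: "row_weight (2 * n + 1) a b = a * (a * b) ^ n"
  by (simp add: row_weight_def power_mult_distrib mult_ac)

fun swap_rows :: "letter \<Rightarrow> letter" where
  "swap_rows LA = LC" | "swap_rows LB = LD" | "swap_rows LC = LA" | "swap_rows LD = LB"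

lemma filling_Suc: "filling (Suc r, s) = x \<longleftrightarrow> filling (r, s) = swap_rows x"
  by (cases x) auto

lemma num_letter_Cons:
  "num_letter x (m # p) = card {s. s < m \<and> filling (0, s) = x} + num_letter (swap_rows x) p"
proof -
  \<comment> \<open>\<open>?A\<close> holds the boxes of the new row 0, \<open>?B\<close> the boxes
    of \<open>p\<close> moved down by one row. The move changes the parity of every row, hence
    \<open>swap_rows\<close>.\<close>
  let ?A = "Pair (0 :: nat) ` {s. s < m \<and> filling (0, s) = x}"
  let ?B = "map_prod Suc id ` {z \<in> boxes p. filling z = swap_rows x}"
  have "(r, s) \<in> {z \<in> boxes (m # p). filling z = x} \<longleftrightarrow> (r, s) \<in> ?A \<union> ?B" for r s
    by (cases r) (auto simp: boxes_def filling_Suc image_iff simp del: filling.simps)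
  then have "{z \<in> boxes (m # p). filling z = x} = ?A \<union> ?B"
    unfolding set_eq_iff split_paired_All by blast
  then have "num_letter x (m # p) = card (?A \<union> ?B)"
    by (simp only: num_letter_def)
  also have "\<dots> = card ?A + card ?B"
    by (intro card_Un_disjoint) (auto simp: finite_boxes)
  also have "card ?A = card {s. s < m \<and> filling (0, s) = x}"
    by (intro card_image) (simp add: inj_on_def)
  also have "card ?B = num_letter (swap_rows x) p"
    unfolding num_letter_def by (intro card_image) (auto simp: inj_on_def)
  finally show ?thesis .
qed

lemma card_even_less: "card {s. s < m \<and> even s} = (m + 1) div 2"
proof (induction m)
  case (Suc m)
  have "{s. s < Suc m \<and> even s} = (if even m then insert m else id) {s. s < m \<and> even s}"
    by (auto simp: less_Suc_eq)
  with Suc show ?case by auto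
qed simp

lemma card_odd_less: "card {s. s < m \<and> odd s} = m div 2"
proof (induction m)
  case (Suc m)
  have "{s. s < Suc m \<and> odd s} = (if odd m then insert m else id) {s. s < m \<and> odd s}"
    by (auto simp: less_Suc_eq)
  with Suc show ?case by auto
qed simp

lemma num_letter_Cons_simps:
  "num_letter LA (m # p) = (m + 1) div 2 + num_letter LC p"
  "num_letter LB (m # p) = m div 2 + num_letter LD p"
  "num_letter LC (m # p) = num_letter LA p"
  "num_letter LD (m # p) = num_letter LB p"
proof -
  have "{s. s < m \<and> filling (0, s) = LA} = {s. s < m \<and> even s}"
    "{s. s < m \<and> filling (0, s) = LB} = {s. s < m \<and> odd s}"
    "{s. s < m \<and> filling (0, s) = LC} = {}" "{s. s < m \<and> filling (0, s) = LD} = {}"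
    by auto
  then show "num_letter LA (m # p) = (m + 1) div 2 + num_letter LC p"
    "num_letter LB (m # p) = m div 2 + num_letter LD p"
    "num_letter LC (m # p) = num_letter LA p"
    "num_letter LD (m # p) = num_letter LB p"
    by (simp_all only: num_letter_Cons card_even_less card_odd_less swap_rows.simps card.empty
        add_0)
qed

lemma weight_Cons: "weight (m # p) a b c d = row_weight m a b * weight p c d a b"
  by (simp add: weight_def row_weight_def num_letter_Cons_simps power_add mult_ac)

lemma weight_Nil: "weight [] a b c d = 1"
  by (simp add: weight_def num_letter_def boxes_def)

section \<open>Recursive structure of \<open>U\<close> and \<open>D\<close>, and the first-order
  recurrences\<close>

lemma U_0: "U 0 = {[]}"
proof -
  have "p = []" if "p \<in> U 0" for p
    using that by (cases p) (auto simp: U_def is_partition_def)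
  moreover have "[] \<in> U 0"
    by (simp add: U_def is_partition_def)
  ultimately show ?thesis by blast
qed

lemma D_0: "D 0 = {[]}"
proof -
  have "p = []" if "p \<in> D 0" for p
    using that by (cases p) (auto simp: D_def is_partition_def)
  moreover have "[] \<in> D 0"
    by (simp add: D_def is_partition_def)
  ultimately show ?thesis by blast
qed

text \<open>The largest part may be repeated, so the tail stays in \<open>U (Suc n)\<close>. This
  makes the recurrence for \<open>Phi\<close> implicit, whereas the tail in \<open>D_Suc\<close>
  drops to \<open>D n\<close>.\<close>

lemma U_Suc: "U (Suc n) = U n \<union> Cons (Suc n) ` U (Suc n)"
proof (intro equalityI subsetI)
  fix p assume p: "p \<in> U (Suc n)"
  show "p \<in> U n \<union> Cons (Suc n) ` U (Suc n)"
  proof (cases p)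
    case Nil
    then show ?thesis by (auto simp: U_def is_partition_def)
  next
    case (Cons m q)
    then show ?thesis
      using p by (cases "m = Suc n") (auto simp: U_def is_partition_def)
  qed
qed (auto simp: U_def is_partition_def)

lemma D_Suc: "D (Suc n) = D n \<union> Cons (Suc n) ` D n"
proof (intro equalityI subsetI)
  fix p assume p: "p \<in> D (Suc n)"
  show "p \<in> D n \<union> Cons (Suc n) ` D n"
  proof (cases p)
    case Nil
    then show ?thesis by (auto simp: D_def is_partition_def)
  next
    case (Cons m q)
    show ?thesis
    proof (cases "m = Suc n")
      case True
      then show ?thesis
        using p unfolding Cons by (auto simp: D_def is_partition_def le_Suc_eq)
    next
      case False
      then show ?thesis
        using p unfolding Cons by (auto simp: D_def is_partition_def)
    qed
  qed
next
  have new: "Suc n \<notin> set q" if "q \<in> D n" for q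
    using that by (auto simp: D_def)
  fix p assume "p \<in> D n \<union> Cons (Suc n) ` D n"
  then show "p \<in> D (Suc n)"
    using new by (auto simp: D_def is_partition_def le_Suc_eq)
qed

lemma Psi_0: "Psi 0 a b c d = 1"
  by (simp add: Psi_def D_0 weight_Nil)

lemma Psi_Suc: "Psi (Suc n) a b c d = Psi n a b c d + row_weight (Suc n) a b * Psi n c d a b"
proof -
  have "D n \<inter> Cons (Suc n) ` D n = {}"
    by (auto simp: D_def)
  then show ?thesis
    unfolding Psi_def D_Suc
    by (simp add: sum.union_disjoint finite_D sum.reindex weight_Cons sum_distrib_left)
qed

lemma Phi_0: "Phi 0 a b c d = 1"
  by (simp add: Phi_def U_0 weight_Nil)

text \<open>Summability is assumed because \<open>infsum\<close> defaults to 0 without it. The two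
  hypotheses serve the two disjoint pieces of \<open>U_Suc\<close>; the second has its variables
  swapped by the deletion of the first row.\<close>

lemma Phi_Suc:
  fixes a b c d :: "'r::comm_ring_1 fps"
  assumes "(\<lambda>p. weight p a b c d) summable_on U n"
    and "(\<lambda>p. weight p c d a b) summable_on U (Suc n)"
  shows "Phi (Suc n) a b c d = Phi n a b c d + row_weight (Suc n) a b * Phi (Suc n) c d a b"
proof -
  have "((\<lambda>p. weight (Suc n # p) a b c d) has_sum row_weight (Suc n) a b * Phi (Suc n) c d a b)
      (U (Suc n))"
    unfolding weight_Cons Phi_def by (intro has_sum_cmult_right has_sum_infsum assms)
  then have "((\<lambda>p. weight p a b c d) has_sum row_weight (Suc n) a b * Phi (Suc n) c d a b)
      (Cons (Suc n) ` U (Suc n))"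
    by (simp add: has_sum_reindex o_def)
  moreover have "((\<lambda>p. weight p a b c d) has_sum Phi n a b c d) (U n)"
    unfolding Phi_def by (intro has_sum_infsum assms)
  moreover have "U n \<inter> Cons (Suc n) ` U (Suc n) = {}"
    by (auto simp: U_def)
  ultimately have "((\<lambda>p. weight p a b c d) has_sum
      (Phi n a b c d + row_weight (Suc n) a b * Phi (Suc n) c d a b)) (U (Suc n))"
    using has_sum_Un_disjoint by (subst U_Suc) blast
  then show ?thesis
    by (simp add: Phi_def[of "Suc n" a b c d] infsumI)
qed

section \<open>Summability of the swapped weights, and \<open>Phi\<close> in terms of
  \<open>Psi\<close>\<close>

lemma finite_U_num_LC: "finite {p \<in> U N. num_letter LC p \<le> n}"
proof (cases "N = 0")
  case True
  then show ?thesis by (simp add: U_0)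
next
  case False
  \<comment> \<open>A new first row of length N turns each \<open>LC\<close> into an
    \<open>LA\<close>, which reduces the claim to \<open>finite_U_num_LA\<close> by injectivity of
    \<open>Cons N\<close>. The case N = 0 is apart since 0 is not a part.\<close>
  then have "Cons N ` {p \<in> U N. num_letter LC p \<le> n} \<subseteq>
      {p \<in> U N. num_letter LA p \<le> (N + 1) div 2 + n}"
    by (auto simp: U_def is_partition_def num_letter_Cons_simps)
  then have "finite (Cons N ` {p \<in> U N. num_letter LC p \<le> n})"
    using finite_U_num_LA finite_subset by blast
  then show ?thesis
    by (rule finite_imageD) simp
qed

text \<open>The topology sees only the outermost variable a, so exchanging (a, b) with (c, d) is no
  symmetry of it. In the swapped weight the exponent of a is the number of \<open>LC\<close>, which
  takes over the role of \<open>LA\<close>.\<close>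

lemma weight_swap_summable:
  "(\<lambda>p. weight p var_c var_d var_a (var_b :: 'k::field fps4)) summable_on U N"
proof -
  let ?F = "\<lambda>p. weight p var_c var_d var_a (var_b :: 'k fps4)"
  have F: "?F p = fps_X ^ num_letter LC p * (var_c ^ num_letter LA p * var_d ^ num_letter LB p *
      var_b ^ num_letter LD p)" for p
    by (simp add: weight_def var_a_def mult_ac)
  have "num_letter LC p \<le> n" if "?F p $ m \<noteq> 0" "m \<le> n" for p m n
    using that unfolding F fps_X_power_mult_nth by (auto split: if_splits)
  then have "{p \<in> U N. \<exists>m\<le>n. ?F p $ m \<noteq> 0} \<subseteq> {p \<in> U N. num_letter LC p \<le> n}" for n
    by blast
  then have "finite {p \<in> U N. \<exists>m\<le>n. ?F p $ m \<noteq> 0}" for n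
    using finite_U_num_LC finite_subset by blast
  then show ?thesis
    by (rule has_sum_imp_summable[OF has_sum_fps])
qed

text \<open>\<open>P\<close> is symmetric under the exchange of (a, b) with (c, d), so one product
  serves both orders of the variables. The recurrences mix the two orders, so the induction carries
  both.\<close>

lemma Phi_eq_Psi:
  fixes a b c d :: "'k::field fps4"
  assumes "a = var_a" "b = var_b" "c = var_c" "d = var_d"
  defines "P \<equiv> \<lambda>n. \<Prod>j<n. 1 - row_weight (Suc j) a b * row_weight (Suc j) c d"
  shows "P n * Phi n a b c d = Psi n a b c d \<and> P n * Phi n c d a b = Psi n c d a b"
proof (induction n)
  case 0
  show ?case by (simp add: P_def Phi_0 Psi_0)
next
  case (Suc n)
  let ?u = "row_weight (Suc n) a b" and ?v = "row_weight (Suc n) c d"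
  have sums: "(\<lambda>p. weight p a b c d) summable_on U m" "(\<lambda>p. weight p c d a b) summable_on U m" for m
    unfolding assms using weight_has_sum weight_swap_summable by (auto simp: summable_on_def)
  have 1: "Phi (Suc n) a b c d = Phi n a b c d + ?u * Phi (Suc n) c d a b"
    and 2: "Phi (Suc n) c d a b = Phi n c d a b + ?v * Phi (Suc n) a b c d"
    by (intro Phi_Suc sums)+
  have P: "P (Suc n) = (1 - ?u * ?v) * P n"
    by (simp add: P_def mult.commute)
  \<comment> \<open>The recurrences \<open>1\<close> and \<open>2\<close> form a linear system for
    the two values at \<open>Suc n\<close>. These forms allow elimination without division.\<close>
  have vX: "?v * Phi (Suc n) a b c d = Phi (Suc n) c d a b - Phi n c d a b"
    and uY: "?u * Phi (Suc n) c d a b = Phi (Suc n) a b c d - Phi n a b c d"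
    using 1[symmetric] 2[symmetric] by (simp_all only: eq_diff_eq add.commute)
  have "(1 - ?u * ?v) * Phi (Suc n) a b c d
      = Phi (Suc n) a b c d - ?u * (?v * Phi (Suc n) a b c d)"
    by (simp add: left_diff_distrib mult.assoc)
  also have "\<dots> = Phi n a b c d + ?u * Phi n c d a b"
    unfolding vX right_diff_distrib uY by simp
  finally have X: "P (Suc n) * Phi (Suc n) a b c d = P n * Phi n a b c d + ?u * (P n * Phi n c d a b)"
    unfolding P by (simp add: mult_ac distrib_left)
  have "(1 - ?u * ?v) * Phi (Suc n) c d a b
      = Phi (Suc n) c d a b - ?v * (?u * Phi (Suc n) c d a b)"
    by (simp add: algebra_simps)
  also have "\<dots> = Phi n c d a b + ?v * Phi n a b c d"
    unfolding uY right_diff_distrib vX by simp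
  finally have Y: "P (Suc n) * Phi (Suc n) c d a b = P n * Phi n c d a b + ?v * (P n * Phi n a b c d)"
    unfolding P by (simp add: mult_ac distrib_left)
  from Suc X Y show ?case
    by (simp add: Psi_Suc)
qed

subsection \<open>Gaussian binomial coefficients\<close>

text \<open>Pascal's rule as a definition avoids division and makes sense in every commutative ring;
  \<open>gauss_binom_qpoch\<close> links it to the quotient in \<open>qbinom\<close>.\<close>

fun gauss_binom :: "nat \<Rightarrow> nat \<Rightarrow> 'r \<Rightarrow> 'r::comm_ring_1" where
  "gauss_binom n 0 q = 1"
| "gauss_binom 0 (Suc i) q = 0"
| "gauss_binom (Suc n) (Suc i) q = gauss_binom n i q + q ^ Suc i * gauss_binom n (Suc i) q"

lemma gauss_binom_eq_0: "n < i \<Longrightarrow> gauss_binom n i q = 0"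
  by (induction n i q rule: gauss_binom.induct) auto

lemma gauss_binom_self: "gauss_binom n n q = 1"
  by (induction n) (simp_all add: gauss_binom_eq_0)

text \<open>This is the ratio of horizontal neighbours, cross-multiplied. Pascal's rule yields it in
  row n + 1 from two adjacent ratios in row n.\<close>

lemma gauss_binom_Suc_right:
  "i \<le> n \<Longrightarrow> (1 - q ^ Suc i) * gauss_binom n (Suc i) q = (1 - q ^ (n - i)) * gauss_binom n i q"
proof (induction n arbitrary: i)
  case (Suc n)
  show ?case
  proof (cases i)
    case 0
    have "(1 - q) * gauss_binom n (Suc 0) q = 1 - q ^ n"
      using Suc.IH[of 0] by simp
    then have "(1 - q) * (1 + q * gauss_binom n (Suc 0) q) = 1 - q + q * (1 - q ^ n)"
      by (simp only: distrib_left mult_1_right mult.left_commute[of "1 - q"])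
    then show ?thesis
      unfolding 0 by (simp add: right_diff_distrib)
  next
    case (Suc j)
    show ?thesis
    proof (cases "j = n")
      case True
      then show ?thesis by (simp add: Suc gauss_binom_eq_0)
    next
      case False
      define k where "k = n - Suc j"
      have j: "j < n"
        using False Suc Suc.prems by simp
      then have n: "n = Suc (j + k)"
        by (simp add: k_def)
      define u where "u = q ^ Suc j"
      define A B C where "A = gauss_binom n j q" and "B = gauss_binom n (Suc j) q"
        and "C = gauss_binom n (Suc (Suc j)) q"
      have AB: "(1 - q ^ Suc k) * A = (1 - u) * B"
        using Suc.IH[of j] by (simp add: n Suc_diff_le u_def A_def B_def)
      have BC: "(1 - q * u) * C = (1 - q ^ k) * B"
        using Suc.IH[of "Suc j"] by (simp add: n u_def B_def C_def)
      \<comment> \<open>Pascal's rule makes \<open>B + q * u * C\<close> and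
        \<open>A + u * B\<close> the two neighbours in row \<open>Suc n\<close>. \<open>BC\<close>
        removes \<open>C\<close>, then \<open>AB\<close> brings in \<open>A\<close>.\<close>
      have "(1 - q * u) * (B + q * u * C) = (1 - q * u) * B + q * u * ((1 - q * u) * C)"
        by (simp add: distrib_left mult_ac)
      also have "\<dots> = (1 - u) * B + u * ((1 - q ^ Suc k) * B)"
        unfolding BC by (simp add: algebra_simps)
      also have "\<dots> = (1 - q ^ Suc k) * (A + u * B)"
        unfolding AB[symmetric] by (simp add: algebra_simps)
      finally show ?thesis
        by (simp add: Suc n Suc_diff_le u_def A_def B_def C_def)
    qed
  qed
qed simp

text \<open>Pascal's rule writes the entry of row n + 1 through two neighbours in row n, and
  \<open>gauss_binom_Suc_right\<close> reduces these to one.\<close>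

lemma gauss_binom_Suc_left:
  assumes "i \<le> Suc n"
  shows "(1 - q ^ (Suc n - i)) * gauss_binom (Suc n) i q = (1 - q ^ Suc n) * gauss_binom n i q"
proof (cases i)
  case (Suc j)
  define k where "k = n - j"
  have n: "n = j + k"
    using assms Suc by (simp add: k_def)
  have "(1 - q ^ Suc j) * gauss_binom n (Suc j) q = (1 - q ^ k) * gauss_binom n j q"
    using gauss_binom_Suc_right[of j n q] by (simp add: n)
  moreover have "q ^ Suc n = q ^ Suc j * q ^ k"
    by (simp add: n power_add)
  moreover have "Suc n - Suc j = k"
    by (simp add: n)
  ultimately show ?thesis
    unfolding Suc gauss_binom.simps by (simp add: algebra_simps)
qed simp

text \<open>Pascal's rule under the sum, with one half shifted in the index: sums of length n + 1
  and n become comparable term by term.\<close>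

lemma sum_gauss_binom_Suc:
  "(\<Sum>i\<le>Suc n. gauss_binom (Suc n) i q * f i) =
     (\<Sum>i\<le>n. gauss_binom n i q * (f (Suc i) + q ^ i * f i))"
proof -
  have "(\<Sum>i\<le>n. gauss_binom n i q * (q ^ i * f i)) = (\<Sum>i\<le>Suc n. gauss_binom n i q * (q ^ i * f i))"
    by (simp add: gauss_binom_eq_0)
  also have "\<dots> = f 0 + (\<Sum>i\<le>n. gauss_binom n (Suc i) q * (q ^ Suc i * f (Suc i)))"
    by (subst sum.atMost_Suc_shift) simp
  finally have "(\<Sum>i\<le>n. gauss_binom n i q * (f (Suc i) + q ^ i * f i)) =
      f 0 + (\<Sum>i\<le>n. gauss_binom (Suc n) (Suc i) q * f (Suc i))"
    by (simp add: algebra_simps sum.distrib)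
  then show ?thesis
    by (subst sum.atMost_Suc_shift) simp
qed

section \<open>The products (x;q)_n and the quotient form of the Gaussian binomials\<close>

lemma qpoch_0: "qpoch x q 0 = 1"
  by (simp add: qpoch_def)

lemma qpoch_Suc: "qpoch x q (Suc n) = qpoch x q n * (1 - x * q ^ n)"
  by (simp add: qpoch_def)

lemma qpoch_Suc_shift: "qpoch x q (Suc n) = (1 - x) * qpoch (x * q) q n"
  unfolding qpoch_def by (subst prod.lessThan_Suc_shift) (simp add: mult.assoc)

lemma qpoch_add: "qpoch x q (m + n) = qpoch x q m * qpoch (x * q ^ m) q n"
  by (induction n) (simp_all add: qpoch_0 qpoch_Suc power_add mult_ac)

text \<open>The induction raises n with i fixed. It starts afresh at i = n + 1, where
  \<open>gauss_binom_Suc_left\<close> only says 0 = 0.\<close>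

lemma gauss_binom_qpoch:
  "i \<le> n \<Longrightarrow> gauss_binom n i q * (qpoch q q i * qpoch q q (n - i)) = qpoch q q n"
proof (induction n)
  case 0
  then show ?case by (simp add: qpoch_0)
next
  case (Suc n)
  show ?case
  proof (cases "i = Suc n")
    case True
    then show ?thesis by (simp only: gauss_binom_self qpoch_0 diff_self_eq_0 mult_1 mult_1_right)
  next
    case False
    then have i: "i \<le> n" "Suc n - i = Suc (n - i)"
      using Suc.prems by auto
    have "gauss_binom (Suc n) i q * (qpoch q q i * qpoch q q (Suc n - i)) =
        ((1 - q ^ (Suc n - i)) * gauss_binom (Suc n) i q) * (qpoch q q i * qpoch q q (n - i))"
      unfolding i(2) qpoch_Suc power_Suc by (simp only: mult_ac)
    also have "\<dots> = (1 - q ^ Suc n) * (gauss_binom n i q * (qpoch q q i * qpoch q q (n - i)))"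
      using Suc.prems by (simp only: gauss_binom_Suc_left mult.assoc)
    also have "\<dots> = qpoch q q (Suc n)"
      unfolding Suc.IH[OF i(1)] qpoch_Suc power_Suc by (simp only: mult.commute)
    finally show ?thesis .
  qed
qed

subsection \<open>Recurrences of order two\<close>

text \<open>The quotient of (ac;q)_{n+\<nu>} by (ac;q)_{i+\<nu>} is written as the product of its
  remaining n - i factors, so no division occurs. The variable d enters only through q, which is a
  free parameter until \<open>Psi_eq_Psi_sum\<close>.\<close>

definition Psi_term :: "nat \<Rightarrow> nat \<Rightarrow> 'r \<Rightarrow> 'r \<Rightarrow> 'r \<Rightarrow> 'r \<Rightarrow> nat \<Rightarrow> 'r::comm_ring_1" where
  "Psi_term \<nu> n a b c q i =
     qpoch (- a) q (i + \<nu>) * qpoch (- (a * b * c)) q i * qpoch (a * c * q ^ (i + \<nu>)) q (n - i) *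
       (a * b) ^ (n - i)"

definition Psi_sum :: "nat \<Rightarrow> nat \<Rightarrow> 'r \<Rightarrow> 'r \<Rightarrow> 'r \<Rightarrow> 'r \<Rightarrow> 'r::comm_ring_1" where
  "Psi_sum \<nu> n a b c q = (\<Sum>i\<le>n. gauss_binom n i q * Psi_term \<nu> n a b c q i)"

lemma Psi_sum_even: "Psi_sum 0 (Suc n) a b c q =
     (1 + b) * Psi_sum 1 n a b c q + (q ^ n * (a * b * c) - b) * Psi_sum 0 n a b c q"
proof -
  have step: "Psi_term 0 (Suc n) a b c q (Suc i) + q ^ i * Psi_term 0 (Suc n) a b c q i =
      (1 + b) * Psi_term 1 n a b c q i + (q ^ n * (a * b * c) - b) * Psi_term 0 n a b c q i"
    if "i \<le> n" for i
  proof -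
    define k where "k = n - i"
    have n: "n = i + k"
      using that by (simp add: k_def)
    define R where "R = qpoch (a * c * q ^ i) q k"
    define S where "S = qpoch (a * c * q ^ Suc i) q k"
    \<comment> \<open>\<open>R\<close> and \<open>S\<close> are products over adjacent windows of k
      factors; each extends to the same product of k + 1 factors.\<close>
    have "R * (1 - a * c * q ^ i * q ^ k) = qpoch (a * c * q ^ i) q (Suc k)"
      by (simp add: qpoch_Suc R_def)
    also have "\<dots> = (1 - a * c * q ^ i) * S"
      by (simp add: qpoch_Suc_shift S_def mult_ac)
    finally have RS: "R * (1 - a * c * q ^ i * q ^ k) = (1 - a * c * q ^ i) * S" .
    define X where "X = qpoch (- a) q i * qpoch (- (a * b * c)) q i * (a * b) ^ k"
    have "Psi_term 0 (Suc n) a b c q (Suc i) = X * ((1 + a * q ^ i) * (1 + a * b * c * q ^ i) * S)"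
      by (simp add: Psi_term_def X_def S_def n qpoch_Suc mult_ac)
    moreover have "Psi_term 0 (Suc n) a b c q i = X * (a * b * (1 - a * c * q ^ i) * S)"
      by (simp add: Psi_term_def X_def S_def n qpoch_Suc_shift[of _ _ k] Suc_diff_le mult_ac)
    moreover have "Psi_term 1 n a b c q i = X * ((1 + a * q ^ i) * S)"
      by (simp add: Psi_term_def X_def S_def n qpoch_Suc mult_ac)
    moreover have "Psi_term 0 n a b c q i = X * R"
      by (simp add: Psi_term_def X_def R_def n mult_ac)
    \<comment> \<open>The coefficient equals -b (1 - a c q^n) and so supplies the factor by which
      \<open>RS\<close> turns \<open>R\<close> into \<open>S\<close>. All terms then share
      \<open>X * S\<close>.\<close>
    moreover have "(q ^ n * (a * b * c) - b) * (X * R) =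
        - b * X * (R * (1 - a * c * q ^ i * q ^ k))"
      by (simp add: n power_add algebra_simps)
    ultimately show ?thesis
      by (simp only: RS) (simp add: algebra_simps)
  qed
  have "Psi_sum 0 (Suc n) a b c q =
      (\<Sum>i\<le>n. gauss_binom n i q * ((1 + b) * Psi_term 1 n a b c q i +
      (q ^ n * (a * b * c) - b) * Psi_term 0 n a b c q i))"
    unfolding Psi_sum_def sum_gauss_binom_Suc by (intro sum.cong refl) (simp only: step atMost_iff)
  also have "\<dots> = (1 + b) * Psi_sum 1 n a b c q + (q ^ n * (a * b * c) - b) * Psi_sum 0 n a b c q"
    by (simp only: Psi_sum_def sum_distrib_left sum.distrib distrib_left[of "gauss_binom _ _ _"]
        mult.left_commute[of "gauss_binom _ _ _"])
  finally show ?thesis .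
qed

lemma Psi_sum_odd: "Psi_sum 1 (Suc n) a b c q =
     (1 + a) * Psi_sum 0 (Suc n) a b c q - a * (1 - q ^ Suc n) * Psi_sum 1 n a b c q"
proof -
  \<comment> \<open>\<open>G\<close> is the telescoping certificate: the combination of summands in
    the recurrence is its forward difference.\<close>
  define G where "G i = a * (1 - q ^ i) * gauss_binom (Suc n) i q * Psi_term 0 (Suc n) a b c q i" for i
  have G: "gauss_binom (Suc n) i q * Psi_term 1 (Suc n) a b c q i -
      (1 + a) * (gauss_binom (Suc n) i q * Psi_term 0 (Suc n) a b c q i) +
      a * (1 - q ^ Suc n) * (gauss_binom n i q * Psi_term 1 n a b c q i) = G (Suc i) - G i"
    if "i \<le> Suc n" for i
  proof (cases "i = Suc n")
    \<comment> \<open>At i = n + 1 the difference n - i would be truncated; here the coefficients in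
      \<open>G (Suc i)\<close> and in the sum for n vanish.\<close>
    case True
    have "G (Suc i) = 0" "gauss_binom n i q = 0" "gauss_binom (Suc n) i q = 1"
      unfolding G_def True by (simp_all only: gauss_binom_eq_0 gauss_binom_self lessI mult_zero_left
          mult_zero_right)
    moreover have "Psi_term 1 (Suc n) a b c q i = (1 + a * q ^ i) * Psi_term 0 (Suc n) a b c q i"
      by (simp add: Psi_term_def True qpoch_0 qpoch_Suc mult_ac)
    ultimately show ?thesis
      by (simp add: G_def True algebra_simps)
  next
    case False
    define k where "k = n - i"
    have n: "n = i + k"
      using False that by (simp add: k_def)
    define S where "S = qpoch (a * c * q ^ Suc i) q k"
    define X where "X = qpoch (- a) q i * qpoch (- (a * b * c)) q i * (a * b) ^ k * S"
    define g where "g = gauss_binom (Suc n) i q"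
    have q: "q ^ Suc n = q ^ i * q ^ Suc k"
      by (simp add: n power_add mult_ac)
    have g1: "(1 - q ^ Suc i) * gauss_binom (Suc n) (Suc i) q = (1 - q ^ Suc k) * g"
      using gauss_binom_Suc_right[of i "Suc n" q] by (simp only: g_def n) (simp add: Suc_diff_le)
    have g2: "(1 - q ^ Suc n) * gauss_binom n i q = (1 - q ^ Suc k) * g"
      using gauss_binom_Suc_left[of i n q] by (simp only: g_def n) (simp add: Suc_diff_le)
    have t1: "Psi_term 1 (Suc n) a b c q i =
        X * (a * b * (1 + a * q ^ i) * (1 - a * c * (q ^ i * q ^ Suc k)))"
      by (simp add: Psi_term_def X_def S_def n qpoch_Suc Suc_diff_le mult_ac)
    have t0: "Psi_term 0 (Suc n) a b c q i = X * (a * b * (1 - a * c * q ^ i))"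
      by (simp add: Psi_term_def X_def S_def n qpoch_Suc_shift[of _ _ k] Suc_diff_le mult_ac)
    have t1': "Psi_term 1 n a b c q i = X * (1 + a * q ^ i)"
      by (simp add: Psi_term_def X_def S_def n qpoch_Suc mult_ac)
    have t0': "Psi_term 0 (Suc n) a b c q (Suc i) = X * ((1 + a * q ^ i) * (1 + a * b * c * q ^ i))"
      by (simp add: Psi_term_def X_def S_def n qpoch_Suc mult_ac)
    have "a * (1 - q ^ Suc n) * (gauss_binom n i q * Psi_term 1 n a b c q i) =
        a * ((1 - q ^ Suc k) * g) * (X * (1 + a * q ^ i))"
      unfolding g2[symmetric] t1' by (simp only: mult_ac)
    moreover have "G (Suc i) =
        a * ((1 - q ^ Suc k) * g) * (X * ((1 + a * q ^ i) * (1 + a * b * c * q ^ i)))"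
      unfolding G_def t0' g1[symmetric] by (simp only: mult_ac)
    moreover have "G i = a * (1 - q ^ i) * g * (X * (a * b * (1 - a * c * q ^ i)))"
      unfolding G_def t0 g_def by (simp only: mult_ac)
    \<comment> \<open>After the common factors are extracted, a polynomial identity remains, with u
      for q^i and t for q^(k+1).\<close>
    moreover have "g * (X * (a * b * (1 + a * u) * (1 - a * c * (u * t)))) -
        (1 + a) * (g * (X * (a * b * (1 - a * c * u)))) + a * ((1 - t) * g) * (X * (1 + a * u)) =
        a * ((1 - t) * g) * (X * ((1 + a * u) * (1 + a * b * c * u))) -
        a * (1 - u) * g * (X * (a * b * (1 - a * c * u)))" for u t
      by (simp add: algebra_simps)
    ultimately show ?thesis
      unfolding g_def[symmetric] t1 t0 by metis
  qed
  have "Psi_sum 1 n a b c q = (\<Sum>i\<le>Suc n. gauss_binom n i q * Psi_term 1 n a b c q i)"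
    by (simp add: Psi_sum_def gauss_binom_eq_0)
  then have "Psi_sum 1 (Suc n) a b c q - (1 + a) * Psi_sum 0 (Suc n) a b c q +
      a * (1 - q ^ Suc n) * Psi_sum 1 n a b c q = (\<Sum>i\<le>Suc n. G (Suc i) - G i)"
    unfolding Psi_sum_def
    by (simp only: sum_distrib_left sum.distrib[symmetric] sum_subtractf[symmetric])
      (intro sum.cong refl G, simp)
  also have "\<dots> = - (\<Sum>i\<le>Suc n. G i - G (Suc i))"
    by (simp only: sum_negf[symmetric] minus_diff_eq)
  \<comment> \<open>Both ends vanish: \<open>G 0\<close> contains 1 - q^0, and the other end
    contains a Gaussian binomial whose lower index exceeds the upper.\<close>
  also have "\<dots> = 0"
    unfolding sum_telescope by (simp only: G_def gauss_binom_eq_0 lessI) simp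
  finally show ?thesis
    by (simp add: algebra_simps)
qed

text \<open>The swapped function is eliminated: the row weight of length m + 1 times
  \<open>Psi m c d a b\<close> is \<open>Psi (Suc m) a b c d - Psi m a b c d\<close>, and k is the
  letter in the added box.\<close>

lemma Psi_Suc_Suc:
  assumes "row_weight (Suc (Suc m)) a b = k * row_weight (Suc m) a b"
  shows "Psi (Suc (Suc m)) a b c d = (1 + k) * Psi (Suc m) a b c d +
    (k * (row_weight (Suc m) a b * row_weight (Suc m) c d) - k) * Psi m a b c d"
  unfolding Psi_Suc[of "Suc m" a b] Psi_Suc[of m] assms by (simp add: algebra_simps)

lemma Psi_even_Suc:
  "Psi (2 * Suc n) a b c d =
     (1 + b) * Psi (2 * n + 1) a b c d +
     ((a * b * c * d) ^ n * (a * b * c) - b) * Psi (2 * n) a b c d"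
proof -
  \<comment> \<open>Lengthening the first row to 2n + 2 adds a box with b, so k = b; in
    \<open>Psi_odd_Suc\<close> the added box has a.\<close>
  have "row_weight (Suc (Suc (2 * n))) a b = b * row_weight (Suc (2 * n)) a b"
    by (simp add: row_weight_def mult_ac)
  moreover have "b * (row_weight (Suc (2 * n)) a b * row_weight (Suc (2 * n)) c d) =
      (a * b * c * d) ^ n * (a * b * c)"
    by (simp add: row_weight_def power_mult_distrib mult_ac)
  ultimately show ?thesis
    using Psi_Suc_Suc[of "2 * n" a b b c d] by simp
qed

lemma Psi_odd_Suc:
  "Psi (2 * Suc n + 1) a b c d =
     (1 + a) * Psi (2 * Suc n) a b c d -
     a * (1 - (a * b * c * d) ^ Suc n) * Psi (2 * n + 1) a b c d"
proof -
  have "row_weight (Suc (Suc (2 * n + 1))) a b = a * row_weight (Suc (2 * n + 1)) a b"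
    by (simp add: row_weight_def mult_ac)
  moreover have "row_weight (Suc (2 * n + 1)) a b * row_weight (Suc (2 * n + 1)) c d =
      (a * b * c * d) ^ Suc n"
    by (simp add: row_weight_def power_mult_distrib mult_ac)
  ultimately show ?thesis
    using Psi_Suc_Suc[of "2 * n + 1" a b a c d] by (simp add: algebra_simps)
qed

text \<open>Both parities go through the induction together, since each recurrence reaches back to
  the two preceding indices.\<close>

lemma Psi_eq_Psi_sum:
  assumes "Q = a * b * c * d"
  shows "Psi (2 * n) a b c d = Psi_sum 0 n a b c Q \<and> Psi (2 * n + 1) a b c d = Psi_sum 1 n a b c Q"
proof (induction n)
  case 0
  have "Psi 1 a b c d = 1 + a"
    using Psi_Suc[of 0 a b c d] by (simp add: Psi_0 row_weight_def)
  then show ?case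
    by (simp add: Psi_0 Psi_sum_def Psi_term_def qpoch_0 qpoch_Suc)
next
  case (Suc n)
  have "Psi (2 * Suc n) a b c d = Psi_sum 0 (Suc n) a b c Q"
    unfolding Psi_even_Suc Psi_sum_even using Suc assms by simp
  then show ?case
    unfolding Psi_odd_Suc Psi_sum_odd using Suc assms by simp
qed

section \<open>The factor between \<open>Phi\<close> and \<open>Psi\<close>, and the closed
  forms\<close>

lemma prod_row_weights:
  fixes a b c d :: "'r::comm_ring_1"
  assumes "\<nu> \<in> {0, 1}" and Q: "Q = a * b * c * d"
  shows "(\<Prod>j<2 * n + \<nu>. 1 - row_weight (Suc j) a b * row_weight (Suc j) c d) =
    qpoch Q Q n * qpoch (a * c) Q (n + \<nu>)"
proof -
  define P where "P m = (\<Prod>j<m. 1 - row_weight (Suc j) a b * row_weight (Suc j) c d)" for m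
  have P_Suc: "P (Suc m) = P m * (1 - row_weight (Suc m) a b * row_weight (Suc m) c d)" for m
    by (simp add: P_def)
  \<comment> \<open>Row length 2m + 1 contributes 1 - a c Q^m and row length 2m + 2 contributes 1 -
    Q^(m+1), so the two parities build the two products separately.\<close>
  have odd: "P (2 * m + 1) = P (2 * m) * (1 - a * c * Q ^ m)" for m
    using P_Suc[of "2 * m"] row_weight_odd[of m a b] row_weight_odd[of m c d]
    by (simp add: Q power_mult_distrib mult_ac)
  have even: "P (2 * Suc m) = P (2 * m + 1) * (1 - Q * Q ^ m)" for m
    using P_Suc[of "2 * m + 1"] row_weight_even[of "Suc m" a b] row_weight_even[of "Suc m" c d]
    by (simp add: Q power_mult_distrib mult_ac)
  have "P (2 * n) = qpoch Q Q n * qpoch (a * c) Q n"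
  proof (induction n)
    case 0
    show ?case by (simp add: P_def qpoch_0)
  next
    case (Suc n)
    then show ?case
      unfolding even odd qpoch_Suc by (simp only: mult_ac)
  qed
  then have "P (2 * n + \<nu>) = qpoch Q Q n * qpoch (a * c) Q (n + \<nu>)"
    using assms(1) odd[of n] by (auto simp: qpoch_Suc mult_ac)
  then show ?thesis by (simp only: P_def)
qed

lemma fps4_mult_divide:
  fixes f g :: "'k::field fps4"
  assumes "g $ 0 = 1"
  shows "f * g / g = f"
proof -
  have "g \<noteq> 0"
    using assms by auto
  then show ?thesis
    using fps4_divide_mult[OF assms, of "f * g"] by simp
qed

theorem theorem6p1:
  fixes N \<nu> :: nat and a b c d Q :: "'k::field fps4"
  assumes "\<nu> \<in> {0, 1}"
    and "a = var_a" and "b = var_b" and "c = var_c" and "d = var_d"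
    and "Q = a * b * c * d"
  shows "Phi (2 * N + \<nu>) a b c d =
           1 / qpoch Q Q N *
           (\<Sum>i=0..N. qbinom N i Q *
              (qpoch (- a) Q (i + \<nu>) * qpoch (- (a * b * c)) Q i / qpoch (a * c) Q (i + \<nu>)) *
              (a * b) ^ (N - i))
       \<and> Psi (2 * N + \<nu>) a b c d =
           (\<Sum>i=0..N. qbinom N i Q * qpoch (- a) Q (i + \<nu>) * qpoch (- (a * b * c)) Q i *
              (qpoch (a * c) Q (N + \<nu>) / qpoch (a * c) Q (i + \<nu>)) *
              (a * b) ^ (N - i))" (is "_ = 1 / ?P * ?S \<and> _")
proof -
  have "a $ 0 = 0"
    by (simp add: assms var_a_def)
  then have [simp]: "Q $ 0 = 0" "a $ 0 = 0"
    by (simp_all add: assms(6))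
  let ?X = "\<lambda>i. qpoch (- a) Q (i + \<nu>) * qpoch (- (a * b * c)) Q i"
  let ?R = "\<lambda>i. qpoch (a * c * Q ^ (i + \<nu>)) Q (N - i)"
  have binom: "qbinom N i Q = gauss_binom N i Q" if "i \<le> N" for i
  proof -
    have "(qpoch Q Q i * qpoch Q Q (N - i)) $ 0 = 1"
      by (simp add: qpoch_nth_0)
    then show ?thesis
      using that fps4_mult_divide[of "qpoch Q Q i * qpoch Q Q (N - i)" "gauss_binom N i Q"]
      by (simp add: qbinom_def gauss_binom_qpoch)
  qed
  have split: "qpoch (a * c) Q (N + \<nu>) = ?R i * qpoch (a * c) Q (i + \<nu>)" if "i \<le> N" for i
    using qpoch_add[of "a * c" Q "i + \<nu>" "N - i"] that by (simp add: ac_simps)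
  have div: "qpoch (a * c) Q (N + \<nu>) / qpoch (a * c) Q (i + \<nu>) = ?R i" if "i \<le> N" for i
    unfolding split[OF that] by (intro fps4_mult_divide qpoch_nth_0) simp
  have Psi: "Psi (2 * N + \<nu>) a b c d =
      (\<Sum>i=0..N. gauss_binom N i Q * (?X i * ?R i * (a * b) ^ (N - i)))"
    using assms(1) Psi_eq_Psi_sum[OF assms(6), of N]
    by (auto simp: Psi_sum_def Psi_term_def atMost_atLeast0)
  \<comment> \<open>The claimed value of \<open>Phi\<close> and \<open>Phi\<close> itself both give
    \<open>Psi\<close> after multiplication by this factor. Its constant coefficient is 1, so it is
    nonzero and cancels at the end.\<close>
  have "?P * qpoch (a * c) Q (N + \<nu>) * (1 / ?P * ?S) =
      (1 / ?P * ?P) * (qpoch (a * c) Q (N + \<nu>) * ?S)"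
    by (simp only: mult_ac)
  also have "1 / ?P * ?P = 1"
    by (intro fps4_divide_mult qpoch_nth_0) simp
  also have "1 * (qpoch (a * c) Q (N + \<nu>) * ?S) = Psi (2 * N + \<nu>) a b c d"
    unfolding Psi mult_1 sum_distrib_left
  proof (intro sum.cong refl)
    fix i assume "i \<in> {0..N}"
    then have i: "i \<le> N" by simp
    define Y where "Y = ?X i / qpoch (a * c) Q (i + \<nu>)"
    have "Y * qpoch (a * c) Q (i + \<nu>) = ?X i"
      unfolding Y_def by (intro fps4_divide_mult qpoch_nth_0) simp
    moreover have "?R i * D * (g * Y * w) = g * (Y * D * ?R i * w)" for D g w
      by (simp only: mult_ac)
    ultimately show "qpoch (a * c) Q (N + \<nu>) * (qbinom N i Q * (?X i / qpoch (a * c) Q (i + \<nu>)) *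
        (a * b) ^ (N - i)) = gauss_binom N i Q * (?X i * ?R i * (a * b) ^ (N - i))"
      unfolding split[OF i] binom[OF i] Y_def[symmetric] by (simp only:)
  qed
  also have "\<dots> = ?P * qpoch (a * c) Q (N + \<nu>) * Phi (2 * N + \<nu>) a b c d"
    using Phi_eq_Psi[OF assms(2-5), of "2 * N + \<nu>"] prod_row_weights[OF assms(1,6), of N] by simp
  finally have *: "?P * qpoch (a * c) Q (N + \<nu>) * (1 / ?P * ?S) =
      ?P * qpoch (a * c) Q (N + \<nu>) * Phi (2 * N + \<nu>) a b c d" .
  have "(?P * qpoch (a * c) Q (N + \<nu>)) $ 0 = 1"
    by (simp add: qpoch_nth_0)
  then have "?P * qpoch (a * c) Q (N + \<nu>) \<noteq> 0"
    by auto
  then have "Phi (2 * N + \<nu>) a b c d = 1 / ?P * ?S"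
    using * by simp
  then show ?thesis
    unfolding Psi by (auto simp: binom div mult.assoc intro!: sum.cong)
qed

unbundle no fps_syntax

end
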